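(* Let $\mathfrak{a}$ and $\mathfrak{b}$ be two distinct confocal ellipses in the Euclidean plane, with billiard maps $\mathcal{A}$ and $\mathcal{B}$ respectively, and let $\ell$ be an oriented line intersecting both ellipses. Let $A\in\mathfrak{a}$ and $O\in\mathfrak{b}$ be the points at which $\ell$ is reflected by $\mathcal{A}$ and by $\mathcal{B}$, respectively; let $B\in\mathfrak{a}$ be the point at which the oriented line $\mathcal{B}(\ell)$ is reflected by $\mathcal{A}$, and let $R\in\mathfrak{b}$ be the point at which the oriented line $\mathcal{A}(\ell)$ is reflected by $\mathcal{B}$. Then the tangent lines to $\mathfrak{a}$ at $A$ and $B$ and the tangent lines to $\mathfrak{b}$ at $O$ and $R$ all pass through a common point (possibly lying on the line at infinity).
   Context: Two ellipses in the Euclidean plane are confocal if they have the same foci. The billiard map in an ellipse $\mathfrak{e}$ acts on oriented lines that intersect $\mathfrak{e}$: given such an oriented line $\ell$, it is reflected at the point $X$ which is the last point of $\mathfrak{e}$ on $\ell$ in the direction of $\ell$ (the tangency point if $\ell$ is tangent to $\mathfrak{e}$), and its image is the oriented line through $X$ whose direction vector is the image of the direction vector of $\ell$ under the reflection in the tangent line to $\mathfrak{e}$ at $X$. The Euclidean plane is completed by a line at infinity to the real projective plane, so a family of mutually parallel lines is regarded as passing through a common point at infinity. *)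

theory Defs
  imports "HOL-Analysis.Analysis"
begin

type_synonym point = "real^2"

(* Circles are included, as the case F = G; confocal circles are the concentric ones.
   The strict inequality rules out segments. *)
definition ellipse_with_foci :: "point \<Rightarrow> point \<Rightarrow> point set \<Rightarrow> bool" where
  "ellipse_with_foci F G e \<longleftrightarrow> (\<exists>s. dist F G < s \<and> e = {X. dist X F + dist X G = s})"

definition confocal_ellipses :: "point set \<Rightarrow> point set \<Rightarrow> bool" where
  "confocal_ellipses a b \<longleftrightarrow> (\<exists>F G. ellipse_with_foci F G a \<and> ellipse_with_foci F G b)"

(* Velocities at X of curves running in e; for a smooth curve e through X this is the
   one-dimensional linear tangent space. *)
definition tangent_space :: "point set \<Rightarrow> point \<Rightarrow> point set" where
  "tangent_space e X =
     {v. \<exists>\<gamma> :: real \<Rightarrow> point. \<gamma> 0 = X \<and> range \<gamma> \<subseteq> e \<and> (\<gamma> has_vector_derivative v) (at 0)}"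

definition tangent_line :: "point set \<Rightarrow> point \<Rightarrow> point set" where
  "tangent_line e X = (\<lambda>v. X + v) ` tangent_space e X"

(* closest_point T is the orthogonal projection onto a linear subspace T. *)
definition reflect_in :: "point set \<Rightarrow> point \<Rightarrow> point" where
  "reflect_in T v = 2 *\<^sub>R closest_point T v - v"

(* An oriented line is its set of points together with its unit direction vector, so
   that equal oriented lines are equal pairs. *)
type_synonym oriented_line = "point set \<times> point"

definition line_through :: "point \<Rightarrow> point \<Rightarrow> oriented_line" where
  "line_through p v = (range (\<lambda>t. p + t *\<^sub>R v), v)"

definition is_oriented_line :: "oriented_line \<Rightarrow> bool" where
  "is_oriented_line l \<longleftrightarrow> (\<exists>p v. norm v = 1 \<and> l = line_through p v)"

definition last_point :: "point set \<Rightarrow> oriented_line \<Rightarrow> point" where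
  "last_point e l =
     (THE X. X \<in> fst l \<inter> e \<and> (\<forall>Y \<in> fst l \<inter> e. Y \<bullet> snd l \<le> X \<bullet> snd l))"

definition billiard_map :: "point set \<Rightarrow> oriented_line \<Rightarrow> oriented_line" where
  "billiard_map e l =
     (let X = last_point e l in line_through X (reflect_in (tangent_space e X) (snd l)))"

(* Points of the projective plane: affine points, and points at infinity given by the
   linear direction shared by a family of parallel lines. *)
datatype projective_point = Affine point | At_infinity "point set"

definition direction :: "point set \<Rightarrow> point set" where
  "direction L = {x - y | x y. x \<in> L \<and> y \<in> L}"

definition projective_closure :: "point set \<Rightarrow> projective_point set" where
  "projective_closure L = Affine ` L \<union> {At_infinity (direction L)}"

end

(* Put the origin at the common centre and let f be half the focal vector. With M(a) = a I - J,
   where J = (f.f) I - f f^T, the ellipse of squared semi-major axis a is x . M(a)^(-1) x = 1, and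
   {x. x . n = 1} is its tangent at M(a) n whenever n . M(a) n = 1. Since M(a) is affine in a,
   confocal families are linear pencils in the dual plane.

   Let n and m be the duals of the tangents at A and Q. Tangents are concurrent exactly when their
   duals are collinear, so it suffices to find the duals of the tangents at R and B on the line
   joining n and m. That line meets the dual conic of the second ellipse in m and in one further
   point m', and the roots of the resulting quadratic show that M(b) m' lies on the reflection at A
   of the line AQ. That it is the last point there, not the first, follows from
   v' . m' = v . m for the directions v, v' before and after reflection, as a point of the ellipse
   is last on a line exactly when the direction has nonnegative product with the normal. B is
   obtained by exchanging the roles of the two ellipses. *)

theory Submission
  imports Defs
begin

section \<open>The quadratic form of a central ellipse and its dual form\<close>

text \<open>The inverse of \<open>pole f \<rho>\<close> when \<open>f \<bullet> f < \<rho>\<close>,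
  by the Sherman-Morrison formula. With the centre as origin it sends a point to the normal of its
  polar line.\<close>

definition polar :: "'a::real_inner \<Rightarrow> real \<Rightarrow> 'a \<Rightarrow> 'a" where
  "polar f \<rho> x = (1 / (\<rho> * (\<rho> - f \<bullet> f))) *\<^sub>R (\<rho> *\<^sub>R x - (f \<bullet> x) *\<^sub>R f)"

definition pole :: "'a::real_inner \<Rightarrow> real \<Rightarrow> 'a \<Rightarrow> 'a" where
  "pole f \<rho> n = (\<rho> - f \<bullet> f) *\<^sub>R n + (f \<bullet> n) *\<^sub>R f"

definition ellipse :: "'a::real_inner \<Rightarrow> 'a \<Rightarrow> real \<Rightarrow> 'a set" where
  "ellipse c f \<rho> = {X. (X - c) \<bullet> polar f \<rho> (X - c) = 1}"

text \<open>The normal is not scaled to unit length: it will be the dual vector of a tangent, whose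
  length is fixed by the conic.\<close>

definition reflect :: "'a::real_inner \<Rightarrow> 'a \<Rightarrow> 'a" where
  "reflect n v = v - (2 * (v \<bullet> n) / (n \<bullet> n)) *\<^sub>R n"

lemma inner_polar_commute: "x \<bullet> polar f \<rho> y = y \<bullet> polar f \<rho> x"
  by (simp add: polar_def inner_diff_right inner_commute mult.commute)

lemma polar_add: "polar f \<rho> (x + y) = polar f \<rho> x + polar f \<rho> y"
  by (simp add: polar_def algebra_simps)

lemma polar_scaleR: "polar f \<rho> (t *\<^sub>R x) = t *\<^sub>R polar f \<rho> x"
  by (simp add: polar_def algebra_simps)

lemma inner_pole_commute: "x \<bullet> pole f \<rho> y = y \<bullet> pole f \<rho> x"
  by (simp add: pole_def inner_add_right inner_commute mult.commute)

lemma pole_add: "pole f \<rho> (x + y) = pole f \<rho> x + pole f \<rho> y"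
  by (simp add: pole_def algebra_simps)

lemma pole_scaleR: "pole f \<rho> (t *\<^sub>R x) = t *\<^sub>R pole f \<rho> x"
  by (simp add: pole_def algebra_simps)

text \<open>Passing to another member of the confocal family adds a multiple of the identity; in
  this form confocality enters the reflection argument.\<close>

lemma pole_shift: "pole f \<rho> x = pole f \<mu> x + (\<rho> - \<mu>) *\<^sub>R x"
  by (simp add: pole_def algebra_simps)

context
  fixes f :: "'a::real_inner" and \<rho> :: real
  assumes ff: "f \<bullet> f < \<rho>"
begin

lemma lam_pos: "0 < \<rho>" "0 < \<rho> - f \<bullet> f" "0 < \<rho> * (\<rho> - f \<bullet> f)"
proof -
  show "0 < \<rho>" using ff inner_ge_zero[of f] by linarith
  then show "0 < \<rho> - f \<bullet> f" "0 < \<rho> * (\<rho> - f \<bullet> f)" using ff by auto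
qed

lemma pole_polar: "pole f \<rho> (polar f \<rho> x) = x"
proof -
  let ?D = "\<rho> * (\<rho> - f \<bullet> f)"
  have "pole f \<rho> (polar f \<rho> x) = (1 / ?D) *\<^sub>R pole f \<rho> (\<rho> *\<^sub>R x - (f \<bullet> x) *\<^sub>R f)"
    by (simp only: polar_def pole_scaleR)
  also have "pole f \<rho> (\<rho> *\<^sub>R x - (f \<bullet> x) *\<^sub>R f) = ?D *\<^sub>R x"
    by (simp add: pole_def algebra_simps)
  finally show ?thesis using lam_pos by simp
qed

lemma polar_pole: "polar f \<rho> (pole f \<rho> n) = n"
proof -
  let ?D = "\<rho> * (\<rho> - f \<bullet> f)"
  have "polar f \<rho> (pole f \<rho> n)
      = (1 / ?D) *\<^sub>R (\<rho> *\<^sub>R pole f \<rho> n - (f \<bullet> pole f \<rho> n) *\<^sub>R f)"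
    by (simp only: polar_def)
  also have "\<rho> *\<^sub>R pole f \<rho> n - (f \<bullet> pole f \<rho> n) *\<^sub>R f = ?D *\<^sub>R n"
    by (simp add: pole_def algebra_simps)
  finally show ?thesis using lam_pos by simp
qed

lemma inner_pole_pos:
  assumes "n \<noteq> 0" shows "0 < n \<bullet> pole f \<rho> n"
proof -
  have "n \<bullet> pole f \<rho> n = (\<rho> - f \<bullet> f) * (n \<bullet> n) + (f \<bullet> n)\<^sup>2"
    by (simp add: pole_def inner_add_right power2_eq_square inner_commute)
  moreover have "0 < (\<rho> - f \<bullet> f) * (n \<bullet> n)"
    using assms lam_pos by simp
  ultimately show ?thesis by (smt (verit) zero_le_power2)
qed

text \<open>The value equals that of the dual form at \<open>polar f \<rho> x\<close>, which is
  positive.\<close>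

lemma inner_polar_pos:
  assumes "x \<noteq> 0" shows "0 < x \<bullet> polar f \<rho> x"
proof -
  have "polar f \<rho> x \<noteq> 0"
    using assms pole_polar[of x] by (auto simp: pole_def)
  from inner_pole_pos[OF this] show ?thesis
    by (simp add: pole_polar inner_commute)
qed

lemma inner_polar_nonneg: "0 \<le> x \<bullet> polar f \<rho> x"
  using inner_polar_pos[of x] by (cases "x = 0") auto

lemma ellipse_pole_iff: "c + pole f \<rho> n \<in> ellipse c f \<rho> \<longleftrightarrow> n \<bullet> pole f \<rho> n = 1"
  by (simp add: ellipse_def polar_pole inner_commute)

end

lemma inner_polar_line:
  "(x + t *\<^sub>R v) \<bullet> polar f \<rho> (x + t *\<^sub>R v)
    = x \<bullet> polar f \<rho> x + 2 * t * (v \<bullet> polar f \<rho> x) + t\<^sup>2 * (v \<bullet> polar f \<rho> v)"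
  using inner_polar_commute[of x f \<rho> v]
  by (simp add: polar_add polar_scaleR power2_eq_square algebra_simps)

section \<open>From the focal definition to the quadratic equation\<close>

text \<open>Either side makes the focal radii \<open>\<sigma> - g / \<sigma>\<close> and
  \<open>\<sigma> + g / \<sigma>\<close>, where \<open>g = f \<bullet> x\<close>. One direction
  isolates a distance and squares; the other extracts square roots.\<close>

lemma sum_dist_foci_iff:
  fixes f :: "'a::real_inner"
  assumes "norm f < \<sigma>"
  shows "norm (x - f) + norm (x + f) = 2 * \<sigma> \<longleftrightarrow> x \<bullet> polar f (\<sigma>\<^sup>2) x = 1"
proof -
  define g where "g = f \<bullet> x"
  have \<sigma>: "0 < \<sigma>" using assms norm_ge_zero[of f] by linarith
  have ff: "f \<bullet> f < \<sigma>\<^sup>2"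
    using assms by (simp add: power2_norm_eq_inner[symmetric] power_strict_mono)
  have u2: "(norm (x - f))\<^sup>2 = x \<bullet> x - 2 * g + f \<bullet> f"
    and w2: "(norm (x + f))\<^sup>2 = x \<bullet> x + 2 * g + f \<bullet> f"
    by (simp_all add: power2_norm_eq_inner g_def inner_diff_left inner_diff_right inner_add_left
        inner_add_right inner_commute)
  have "x \<bullet> polar f (\<sigma>\<^sup>2) x = (\<sigma>\<^sup>2 * (x \<bullet> x) - g\<^sup>2) / (\<sigma>\<^sup>2 * (\<sigma>\<^sup>2 - f \<bullet> f))"
    by (simp add: polar_def inner_diff_right g_def power2_eq_square inner_commute)
  then have eq: "x \<bullet> polar f (\<sigma>\<^sup>2) x = 1 \<longleftrightarrow> \<sigma>\<^sup>2 * (x \<bullet> x) - g\<^sup>2 = \<sigma>\<^sup>2 * (\<sigma>\<^sup>2 - f \<bullet> f)"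
    using ff \<sigma> by (simp add: divide_eq_eq)
  show ?thesis unfolding eq
  proof
    assume s: "norm (x - f) + norm (x + f) = 2 * \<sigma>"
    have "(2 * \<sigma> - norm (x + f))\<^sup>2 = x \<bullet> x - 2 * g + f \<bullet> f"
      using u2 s by (metis add_diff_cancel_right')
    then have "\<sigma> * norm (x + f) = \<sigma>\<^sup>2 + g"
      using w2 by (simp add: power2_eq_square algebra_simps)
    then have "\<sigma>\<^sup>2 * (norm (x + f))\<^sup>2 = (\<sigma>\<^sup>2 + g)\<^sup>2"
      by (metis power_mult_distrib)
    then show "\<sigma>\<^sup>2 * (x \<bullet> x) - g\<^sup>2 = \<sigma>\<^sup>2 * (\<sigma>\<^sup>2 - f \<bullet> f)"
      unfolding w2 by (simp add: power2_eq_square algebra_simps)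
  next
    assume e: "\<sigma>\<^sup>2 * (x \<bullet> x) - g\<^sup>2 = \<sigma>\<^sup>2 * (\<sigma>\<^sup>2 - f \<bullet> f)"
    \<comment> \<open>Cauchy-Schwarz bounds \<open>g\<close> once \<open>x \<bullet> x\<close> is
      eliminated through \<open>e\<close>. Both \<open>\<sigma>\<^sup>2 - g\<close> and
      \<open>\<sigma>\<^sup>2 + g\<close> are then positive, which settles the signs of the square
      roots below.\<close>
    have "\<bar>g\<bar> < \<sigma>\<^sup>2"
    proof -
      have "g\<^sup>2 \<le> (f \<bullet> f) * (x \<bullet> x)"
        unfolding g_def by (rule Cauchy_Schwarz_ineq)
      then have "\<sigma>\<^sup>2 * g\<^sup>2 \<le> (f \<bullet> f) * (\<sigma>\<^sup>2 * (x \<bullet> x))"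
        using \<sigma> by (simp add: mult.left_commute)
      also have "\<sigma>\<^sup>2 * (x \<bullet> x) = g\<^sup>2 + \<sigma>\<^sup>2 * (\<sigma>\<^sup>2 - f \<bullet> f)" using e by simp
      finally have "(\<sigma>\<^sup>2 - f \<bullet> f) * g\<^sup>2 \<le> (\<sigma>\<^sup>2 - f \<bullet> f) * ((f \<bullet> f) * \<sigma>\<^sup>2)"
        by (simp add: algebra_simps)
      then have "g\<^sup>2 \<le> (f \<bullet> f) * \<sigma>\<^sup>2" using ff by simp
      also have "\<dots> < \<sigma>\<^sup>2 * \<sigma>\<^sup>2" using ff \<sigma> by (intro mult_strict_right_mono) auto
      finally have "\<bar>g\<bar>\<^sup>2 < (\<sigma>\<^sup>2)\<^sup>2" by (simp add: power2_eq_square)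
      then show ?thesis by (rule power2_less_imp_less) simp
    qed
    moreover have "(\<sigma> * norm (x - f))\<^sup>2 = (\<sigma>\<^sup>2 - g)\<^sup>2" "(\<sigma> * norm (x + f))\<^sup>2 = (\<sigma>\<^sup>2 + g)\<^sup>2"
      unfolding power_mult_distrib u2 w2 using e by (simp_all add: power2_eq_square algebra_simps)
    ultimately have "\<sigma> * norm (x - f) = \<sigma>\<^sup>2 - g" "\<sigma> * norm (x + f) = \<sigma>\<^sup>2 + g"
      using \<sigma> by (auto intro!: power2_eq_imp_eq)
    then have "\<sigma> * (norm (x - f) + norm (x + f)) = \<sigma> * (2 * \<sigma>)"
      by (simp add: algebra_simps power2_eq_square)
    then show "norm (x - f) + norm (x + f) = 2 * \<sigma>" using \<sigma> by simp
  qed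
qed

lemma sum_dist_eq_ellipse:
  fixes F G :: "'a::real_inner"
  assumes "dist F G < s"
  shows "{X. dist X F + dist X G = s}
          = ellipse (midpoint F G) ((1/2) *\<^sub>R (F - G)) ((s/2)\<^sup>2)" (is "_ = ellipse ?c ?f _")
    and "((1/2) *\<^sub>R (F - G)) \<bullet> ((1/2) *\<^sub>R (F - G)) < (s/2)\<^sup>2"
proof -
  have n: "norm ?f < s/2" using assms by (simp add: dist_norm)
  have foci: "X - ?c - ?f = X - F" "X - ?c + ?f = X - G" for X
    by (simp_all add: midpoint_def algebra_simps flip: scaleR_add_left)
  have "dist X F + dist X G = s \<longleftrightarrow> norm (X - ?c - ?f) + norm (X - ?c + ?f) = 2 * (s/2)" for X
    unfolding foci by (simp add: dist_norm)
  then show "{X. dist X F + dist X G = s} = ellipse ?c ?f ((s/2)\<^sup>2)"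
    unfolding sum_dist_foci_iff[OF n] ellipse_def by blast
  show "?f \<bullet> ?f < (s/2)\<^sup>2"
    using n unfolding power2_norm_eq_inner[symmetric] by (simp add: power_strict_mono)
qed

section \<open>The last point of an ellipse on a line\<close>

text \<open>A point \<open>X + t *\<^sub>R v\<close> of the ellipse satisfies
  \<open>t * (2 * k + t * q) = 0\<close>, where \<open>k \<ge> 0\<close> is the product of
  \<open>v\<close> with the normal at \<open>X\<close> and \<open>q > 0\<close> is the value of the
  form at \<open>v\<close>. Hence \<open>t \<le> 0\<close>.\<close>

lemma last_point_eqI:
  fixes X c f :: point
  assumes ff: "f \<bullet> f < \<rho>" and v: "v \<noteq> 0"
    and X: "X \<in> range (\<lambda>t. p + t *\<^sub>R v)" "X \<in> ellipse c f \<rho>"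
    and out: "0 \<le> v \<bullet> polar f \<rho> (X - c)"
  shows "last_point (ellipse c f \<rho>) (line_through p v) = X"
proof -
  have max: "\<exists>t\<le>0. Y = X + t *\<^sub>R v"
    if Y: "Y \<in> range (\<lambda>t. p + t *\<^sub>R v)" "Y \<in> ellipse c f \<rho>" for Y
  proof -
    obtain t1 t2 where "X = p + t1 *\<^sub>R v" "Y = p + t2 *\<^sub>R v" using X Y by auto
    then have "Y = X + (t2 - t1) *\<^sub>R v" by (simp add: algebra_simps)
    then obtain t where t: "Y = X + t *\<^sub>R v" by blast
    have Yc: "Y - c = (X - c) + t *\<^sub>R v" using t by simp
    have "(Y - c) \<bullet> polar f \<rho> (Y - c)
        = 1 + t * (2 * (v \<bullet> polar f \<rho> (X - c)) + t * (v \<bullet> polar f \<rho> v))"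
      unfolding Yc inner_polar_line using X by (simp add: ellipse_def power2_eq_square distrib_left)
    then have "t * (2 * (v \<bullet> polar f \<rho> (X - c)) + t * (v \<bullet> polar f \<rho> v)) = 0"
      using Y by (simp add: ellipse_def)
    then have "t = 0 \<or> t * (v \<bullet> polar f \<rho> v) \<le> 0" using out by auto
    with inner_polar_pos[OF ff v] have "t \<le> 0" by (auto simp: mult_le_0_iff)
    with t show ?thesis by blast
  qed
  \<comment> \<open>The second conjunct supplies the uniqueness that \<open>THE\<close>
    requires.\<close>
  have "(Y - X) \<bullet> v \<le> 0 \<and> (0 \<le> (Y - X) \<bullet> v \<longrightarrow> Y = X)"
    if Y: "Y \<in> range (\<lambda>t. p + t *\<^sub>R v)" "Y \<in> ellipse c f \<rho>" for Y
  proof -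
    obtain t where t: "t \<le> 0" "Y = X + t *\<^sub>R v" using max[OF Y] by blast
    then have "(Y - X) \<bullet> v = t * (norm v)\<^sup>2" by (simp add: power2_norm_eq_inner)
    then show ?thesis using t v by (auto simp: mult_le_0_iff zero_le_mult_iff)
  qed
  then have *: "Y \<bullet> v \<le> X \<bullet> v" "X \<bullet> v \<le> Y \<bullet> v \<Longrightarrow> Y = X"
    if "Y \<in> range (\<lambda>t. p + t *\<^sub>R v)" "Y \<in> ellipse c f \<rho>" for Y
    using that by (auto simp: inner_diff_left)
  show ?thesis
    unfolding last_point_def line_through_def fst_conv snd_conv
    by (rule the_equality) (use X * in blast)+
qed

text \<open>If the line enters the ellipse at the given common point, it leaves at the other root;
  \<open>last_point_eqI\<close> identifies the exit with the last point.\<close>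

lemma last_point_props:
  fixes p c f :: point
  assumes ff: "f \<bullet> f < \<rho>" and v: "v \<noteq> 0"
    and ne: "range (\<lambda>t. p + t *\<^sub>R v) \<inter> ellipse c f \<rho> \<noteq> {}"
    and X: "X = last_point (ellipse c f \<rho>) (line_through p v)"
  shows "X \<in> range (\<lambda>t. p + t *\<^sub>R v)" "X \<in> ellipse c f \<rho>" "0 \<le> v \<bullet> polar f \<rho> (X - c)"
proof -
  obtain t0 where t0: "p + t0 *\<^sub>R v \<in> ellipse c f \<rho>" using ne by auto
  define Y where "Y = p + t0 *\<^sub>R v"
  define k where "k = v \<bullet> polar f \<rho> (Y - c)"
  define q where "q = v \<bullet> polar f \<rho> v"
  have q: "0 < q" unfolding q_def by (rule inner_polar_pos[OF ff v])
  have "\<exists>Z. Z \<in> range (\<lambda>t. p + t *\<^sub>R v) \<and> Z \<in> ellipse c f \<rho> \<and> 0 \<le> v \<bullet> polar f \<rho> (Z - c)"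
  proof (cases "0 \<le> k")
    case True
    then show ?thesis using t0 unfolding k_def Y_def by blast
  next
    case False
    \<comment> \<open>The other root of \<open>t * (2 * k + t * q) = 0\<close>. The product of
      \<open>v\<close> with the normal there is \<open>k + t * q = - k\<close>, so its sign is
      reversed.\<close>
    define t where "t = - 2 * k / q"
    have Zc: "Y + t *\<^sub>R v - c = (Y - c) + t *\<^sub>R v" by simp
    have tq: "t * q = - 2 * k" using q by (simp add: t_def)
    have "(Y - c) \<bullet> polar f \<rho> (Y - c) = 1" using t0 by (simp add: ellipse_def Y_def)
    then have "(Y - c + t *\<^sub>R v) \<bullet> polar f \<rho> (Y - c + t *\<^sub>R v) = 1 + t * (2 * k + t * q)"
      unfolding inner_polar_line k_def q_def by (simp add: power2_eq_square algebra_simps)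
    then have "Y + t *\<^sub>R v \<in> ellipse c f \<rho>"
      unfolding ellipse_def mem_Collect_eq Zc by (simp add: tq)
    moreover have "v \<bullet> polar f \<rho> (Y + t *\<^sub>R v - c) = - k"
      unfolding Zc using tq by (simp add: polar_add polar_scaleR inner_add_right k_def q_def)
    moreover have "Y + t *\<^sub>R v = p + (t0 + t) *\<^sub>R v" by (simp add: Y_def algebra_simps)
    ultimately show ?thesis using False
      by (metis (no_types, lifting) linorder_le_cases neg_0_le_iff_le rangeI)
  qed
  then obtain Z where Z: "Z \<in> range (\<lambda>t. p + t *\<^sub>R v)" "Z \<in> ellipse c f \<rho>"
    "0 \<le> v \<bullet> polar f \<rho> (Z - c)" by blast
  have "X = Z" using last_point_eqI[OF ff v Z] X by simp
  with Z show "X \<in> range (\<lambda>t. p + t *\<^sub>R v)" "X \<in> ellipse c f \<rho>" "0 \<le> v \<bullet> polar f \<rho> (X - c)"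
    by auto
qed

section \<open>Tangents and the reflection in them\<close>

text \<open>Differentiating the constant quadratic form along a curve gives one inclusion; an
  explicit curve with the prescribed velocity gives the other.\<close>

lemma tangent_space_ellipse:
  fixes X c f :: point
  assumes ff: "f \<bullet> f < \<rho>" and X: "X \<in> ellipse c f \<rho>"
  shows "tangent_space (ellipse c f \<rho>) X = {v. v \<bullet> polar f \<rho> (X - c) = 0}"
proof (intro set_eqI iffI; clarsimp)
  fix v assume "v \<in> tangent_space (ellipse c f \<rho>) X"
  then obtain \<gamma> :: "real \<Rightarrow> point" where \<gamma>: "\<gamma> 0 = X" "range \<gamma> \<subseteq> ellipse c f \<rho>"
    "(\<gamma> has_vector_derivative v) (at 0)" by (auto simp: tangent_space_def)
  have bl: "bounded_linear (polar f \<rho>)"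
    unfolding polar_def by (intro bounded_linear_intros)
  have 1: "((\<lambda>t. \<gamma> t - c) has_vector_derivative v) (at 0)"
    using \<gamma>(3) by (auto intro!: derivative_eq_intros)
  have 2: "((\<lambda>t. polar f \<rho> (\<gamma> t - c)) has_vector_derivative polar f \<rho> v) (at 0)"
    by (rule bounded_linear.has_vector_derivative[OF bl 1])
  have "((\<lambda>t. (\<gamma> t - c) \<bullet> polar f \<rho> (\<gamma> t - c)) has_vector_derivative
      (\<gamma> 0 - c) \<bullet> polar f \<rho> v + v \<bullet> polar f \<rho> (\<gamma> 0 - c)) (at 0)"
    by (rule bounded_bilinear.has_vector_derivative[OF bounded_bilinear_inner 1 2])
  moreover have "(\<lambda>t. (\<gamma> t - c) \<bullet> polar f \<rho> (\<gamma> t - c)) = (\<lambda>t. 1)"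
    using \<gamma>(2) by (auto simp: ellipse_def)
  ultimately have "(X - c) \<bullet> polar f \<rho> v + v \<bullet> polar f \<rho> (X - c) = 0"
    using \<gamma>(1) vector_derivative_unique_at has_vector_derivative_const by metis
  then show "v \<bullet> polar f \<rho> (X - c) = 0"
    using inner_polar_commute[of v f \<rho> "X - c"] by simp
next
  fix v assume v: "v \<bullet> polar f \<rho> (X - c) = 0"
  define q where "q = v \<bullet> polar f \<rho> v"
  have q: "0 \<le> q" unfolding q_def by (rule inner_polar_nonneg[OF ff])
  txt \<open>Project the tangent line radially from the centre back to the ellipse.\<close>
  define h where "h t = 1 / sqrt (1 + t\<^sup>2 * q)" for t
  define \<gamma> where "\<gamma> t = c + h t *\<^sub>R ((X - c) + t *\<^sub>R v)" for t
  have pos: "0 < 1 + t\<^sup>2 * q" for t using q by (simp add: add_pos_nonneg)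
  have "\<gamma> t \<in> ellipse c f \<rho>" for t
  proof -
    have "(\<gamma> t - c) \<bullet> polar f \<rho> (\<gamma> t - c) = (h t)\<^sup>2 * (1 + t\<^sup>2 * q)"
      using X v unfolding \<gamma>_def
      by (simp add: polar_scaleR inner_polar_line ellipse_def q_def power2_eq_square)
    also have "\<dots> = 1" using pos[of t] by (simp add: h_def power_divide)
    finally show ?thesis by (simp add: ellipse_def)
  qed
  moreover have "\<gamma> 0 = X" by (simp add: \<gamma>_def h_def)
  moreover have "(\<gamma> has_vector_derivative v) (at 0)"
  proof -
    \<comment> \<open>The factor \<open>h\<close> is even with \<open>h 0 = 1\<close>, so the
      product rule leaves exactly the velocity \<open>v\<close>.\<close>
    have "(h has_real_derivative 0) (at 0)"
      unfolding h_def by (auto intro!: derivative_eq_intros)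
    then show ?thesis unfolding \<gamma>_def
      by (auto intro!: derivative_eq_intros simp: h_def)
  qed
  ultimately show "v \<in> tangent_space (ellipse c f \<rho>) X"
    unfolding tangent_space_def by blast
qed

lemma tangent_line_ellipse:
  fixes X c f :: point
  assumes ff: "f \<bullet> f < \<rho>" and X: "X \<in> ellipse c f \<rho>"
  shows "tangent_line (ellipse c f \<rho>) X = {Y. (Y - c) \<bullet> polar f \<rho> (X - c) = 1}"
proof -
  have "(Y - c) \<bullet> polar f \<rho> (X - c) = 1 + (Y - X) \<bullet> polar f \<rho> (X - c)" for Y
    using X by (simp add: ellipse_def inner_diff_left)
  then show ?thesis
    unfolding tangent_line_def tangent_space_ellipse[OF ff X]
    by (auto simp: image_iff intro!: exI[of _ "_ - X"])
qed

text \<open>The foot of the perpendicular has distance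
  \<open>\<bar>v \<bullet> n\<bar> / norm n\<close> from \<open>v\<close>. By Cauchy-Schwarz no
  point of the hyperplane is nearer, so the foot is the closest point.\<close>

lemma reflect_in_hyperplane:
  fixes n :: point
  assumes "n \<noteq> 0"
  shows "reflect_in {v. v \<bullet> n = 0} v = reflect n v"
proof -
  let ?T = "{v. v \<bullet> n = 0}" and ?w = "v - ((v \<bullet> n) / (n \<bullet> n)) *\<^sub>R n"
  have T: "?T = {v. n \<bullet> v = 0}" by (simp add: inner_commute)
  have w: "?w \<in> ?T" using assms by (simp add: inner_diff_left)
  have "dist v ?w \<le> dist v z" if "z \<in> ?T" for z
  proof -
    have "\<bar>v \<bullet> n\<bar> = \<bar>(v - z) \<bullet> n\<bar>" using that by (simp add: inner_diff_left)
    also have "\<dots> \<le> norm (v - z) * norm n" by (rule Cauchy_Schwarz_ineq2)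
    finally have "\<bar>v \<bullet> n\<bar> \<le> norm (v - z) * norm n" .
    then show ?thesis using assms
      by (simp add: dist_norm power2_norm_eq_inner[symmetric] power2_eq_square divide_le_eq)
  qed
  then have cp: "?w = closest_point ?T v"
    using w by (intro closest_point_unique) (auto simp: T convex_hyperplane closed_hyperplane)
  have "(2 * (v \<bullet> n) / (n \<bullet> n)) *\<^sub>R n
      = ((v \<bullet> n) / (n \<bullet> n)) *\<^sub>R n + ((v \<bullet> n) / (n \<bullet> n)) *\<^sub>R n"
    by (simp flip: scaleR_add_left)
  then show ?thesis
    unfolding reflect_in_def reflect_def cp[symmetric] by (simp add: scaleR_2)
qed

text \<open>If the image vanished, the product with \<open>n\<close> would give
  \<open>v \<bullet> n = 2 * (v \<bullet> n)\<close>, hence \<open>v = 0\<close>.\<close>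

lemma reflect_nonzero:
  assumes "v \<noteq> 0" shows "reflect n v \<noteq> 0"
proof
  assume "reflect n v = 0"
  then have v: "v = (2 * (v \<bullet> n) / (n \<bullet> n)) *\<^sub>R n" by (simp add: reflect_def)
  then have "v \<bullet> n = (2 * (v \<bullet> n) / (n \<bullet> n)) * (n \<bullet> n)" by (metis inner_scaleR_left)
  then have "v \<bullet> n = 0" by (cases "n = 0") auto
  with v assms show False by simp
qed

section \<open>Reflection inside the confocal pencil\<close>

text \<open>With the centre as origin, \<open>n\<close> and \<open>m\<close> are the duals of the
  tangents at the points \<open>pole f a n\<close> and \<open>pole f b m\<close> of the incoming
  line. The conclusions place the new dual on the dual conic of \<open>b\<close>, its contact point
  on the reflected line, and carry over the sign that singles out last points.\<close>

lemma confocal_reflection: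
  fixes f n m v :: "'a::real_inner"
  assumes ffb: "f \<bullet> f < b" and ab: "a \<noteq> b"
    and n: "n \<bullet> pole f a n = 1" and m: "m \<bullet> pole f b m = 1"
    and v: "pole f b m - pole f a n = \<tau> *\<^sub>R v" and \<tau>: "\<tau> \<noteq> 0"
  obtains \<kappa> where "(n + \<kappa> *\<^sub>R (m - n)) \<bullet> pole f b (n + \<kappa> *\<^sub>R (m - n)) = 1"
    and "pole f b (n + \<kappa> *\<^sub>R (m - n)) - pole f a n = (\<kappa> * \<tau>) *\<^sub>R reflect n v"
    and "reflect n v \<bullet> (n + \<kappa> *\<^sub>R (m - n)) = v \<bullet> m"
proof
  define d where "d = m - n"
  have md: "m = n + d" by (simp add: d_def)
  have n0: "n \<noteq> 0" using n by auto
  then have nn: "0 < n \<bullet> n" by simp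
  have pb: "pole f b x = pole f a x + (b - a) *\<^sub>R x" for x by (rule pole_shift)
  define D where "D = d \<bullet> pole f b d"
  define E where "E = d \<bullet> pole f b n"
  define N where "N = (b - a) * (n \<bullet> n)"
  have nbn: "n \<bullet> pole f b n = 1 + N" using n by (simp add: pb inner_add_right N_def)
  have E': "n \<bullet> pole f b d = E" by (simp add: E_def inner_pole_commute)
  have DEN: "D + 2 * E + N = 0"
    using m nbn by (simp add: md pole_add inner_add_left inner_add_right D_def E' E_def)
  \<comment> \<open>Distinct confocal ellipses have no common tangent: a common dual would force
    \<open>(b - a) * (n \<bullet> n) = 0\<close>.\<close>
  have "d \<noteq> 0"
  proof
    assume "d = 0"
    then have "N = 0" using DEN by (simp add: D_def E_def)
    then show False using nn ab by (simp add: N_def)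
  qed
  then have D: "0 < D" unfolding D_def by (rule inner_pole_pos[OF ffb])
  txt \<open>On the line through \<open>n\<close> and \<open>m\<close> the dual conic is \<open>1 + N + 2 * t * E + t\<^sup>2 * D = 1\<close>. One root is
    \<open>t = 1\<close>, so the other is the product \<open>N / D\<close> of the roots.\<close>
  define \<kappa> where "\<kappa> = N / D"
  have \<kappa>D: "\<kappa> * D = N" using D by (simp add: \<kappa>_def)
  have \<kappa>0: "\<kappa> \<noteq> 0" using D nn ab by (simp add: \<kappa>_def N_def)
  have "(n + \<kappa> *\<^sub>R d) \<bullet> pole f b (n + \<kappa> *\<^sub>R d) = 1 + N + 2 * \<kappa> * E + \<kappa> * (\<kappa> * D)"
    by (simp add: pole_add pole_scaleR inner_add_left inner_add_right nbn E' D_def[symmetric]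
        E_def[symmetric] algebra_simps)
  also have "\<dots> = 1 + \<kappa> * (D + 2 * E + N)"
    unfolding \<kappa>D using \<kappa>D by (simp add: algebra_simps)
  finally show 1: "(n + \<kappa> *\<^sub>R (m - n)) \<bullet> pole f b (n + \<kappa> *\<^sub>R (m - n)) = 1"
    by (simp add: DEN d_def)
  have \<tau>v: "\<tau> *\<^sub>R v = pole f b d + (b - a) *\<^sub>R n"
    unfolding v[symmetric] by (simp add: md pole_add pb[of n])
  have \<tau>vn: "\<tau> * (v \<bullet> n) = E + N"
    using arg_cong[OF \<tau>v, of "\<lambda>x. x \<bullet> n"] E' by (simp add: inner_add_left N_def inner_commute[of "pole f b d"])
  \<comment> \<open>Reflection changes only the component along \<open>n\<close>. By
    \<open>DEN\<close> the coefficient \<open>b - a\<close> of \<open>n\<close> turns into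
    \<open>D / (n \<bullet> n)\<close>, and the factor \<open>\<kappa> = N / D\<close> restores it
    to \<open>b - a\<close>.\<close>
  have "\<tau> *\<^sub>R reflect n v = \<tau> *\<^sub>R v - (2 * (\<tau> * (v \<bullet> n)) / (n \<bullet> n)) *\<^sub>R n"
    by (simp add: reflect_def algebra_simps)
  also have "\<dots> = pole f b d + ((b - a) - 2 * (E + N) / (n \<bullet> n)) *\<^sub>R n"
    unfolding \<tau>vn \<tau>v by (simp add: algebra_simps)
  also have "(b - a) - 2 * (E + N) / (n \<bullet> n) = D / (n \<bullet> n)"
    using DEN nn by (simp add: N_def field_simps)
  finally have "(\<kappa> * \<tau>) *\<^sub>R reflect n v = \<kappa> *\<^sub>R pole f b d + (\<kappa> * D / (n \<bullet> n)) *\<^sub>R n"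
    by (metis scaleR_add_right scaleR_scaleR times_divide_eq_right)
  also have "\<kappa> * D / (n \<bullet> n) = b - a" using nn by (simp add: \<kappa>D N_def)
  finally show 2: "pole f b (n + \<kappa> *\<^sub>R (m - n)) - pole f a n = (\<kappa> * \<tau>) *\<^sub>R reflect n v"
    by (simp add: d_def[symmetric] pole_add pole_scaleR pb[of n])
  \<comment> \<open>Since \<open>pole f a n \<bullet> (n + t *\<^sub>R d) = 1 + t * K\<close>, while
    each contact point on the ellipse of \<open>b\<close> has product 1 with its own dual, the two
    products are \<open>- K\<close> and \<open>\<kappa> * (- K)\<close>; cancelling
    \<open>\<kappa>\<close> gives the equality.\<close>
  define K where "K = n \<bullet> pole f a d"
  have K: "pole f a n \<bullet> d = K" by (simp add: K_def inner_pole_commute inner_commute)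
  have "\<tau> * (v \<bullet> m) = (pole f b m - pole f a n) \<bullet> m" unfolding v by simp
  also have "\<dots> = 1 - pole f a n \<bullet> m" using m by (simp add: inner_diff_left inner_commute inner_diff_right)
  also have "\<dots> = - K" using n K by (simp add: md inner_add_left inner_add_right inner_commute)
  finally have vm: "\<tau> * (v \<bullet> m) = - K" .
  have "\<kappa> * (\<tau> * (reflect n v \<bullet> (n + \<kappa> *\<^sub>R d)))
      = (pole f b (n + \<kappa> *\<^sub>R d) - pole f a n) \<bullet> (n + \<kappa> *\<^sub>R d)"
    using 2 by (simp add: d_def)
  also have "\<dots> = 1 - pole f a n \<bullet> (n + \<kappa> *\<^sub>R d)"
    unfolding inner_diff_left using 1 by (simp add: d_def inner_commute)
  also have "\<dots> = \<kappa> * (- K)" using n K by (simp add: inner_add_right inner_commute)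
  finally have "\<tau> * (reflect n v \<bullet> (n + \<kappa> *\<^sub>R d)) = \<tau> * (v \<bullet> m)"
    unfolding vm mult_left_cancel[OF \<kappa>0] .
  then show "reflect n v \<bullet> (n + \<kappa> *\<^sub>R (m - n)) = v \<bullet> m" using \<tau> by (simp add: d_def)
qed

text \<open>The contact point of the new tangent lies on the reflected line and passes the sign test
  for last points, so it is \<open>R\<close>. Exchanging \<open>(a, A)\<close> with
  \<open>(b, Q)\<close> will yield the corresponding fact for the other order of
  reflections.\<close>

lemma confocal_billiard:
  fixes p v c f :: point
  assumes ffa: "f \<bullet> f < a" and ffb: "f \<bullet> f < b" and ab: "a \<noteq> b" and v: "v \<noteq> 0"
    and AQ: "A \<noteq> Q"
    and nea: "range (\<lambda>t. p + t *\<^sub>R v) \<inter> ellipse c f a \<noteq> {}"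
    and neb: "range (\<lambda>t. p + t *\<^sub>R v) \<inter> ellipse c f b \<noteq> {}"
    and A: "A = last_point (ellipse c f a) (line_through p v)"
    and Q: "Q = last_point (ellipse c f b) (line_through p v)"
    and R: "R = last_point (ellipse c f b) (billiard_map (ellipse c f a) (line_through p v))"
  obtains \<kappa> where "R \<in> ellipse c f b"
    and "polar f b (R - c)
          = polar f a (A - c) + \<kappa> *\<^sub>R (polar f b (Q - c) - polar f a (A - c))"
proof -
  note Ap = last_point_props[OF ffa v nea A] and Qp = last_point_props[OF ffb v neb Q]
  define n where "n = polar f a (A - c)"
  define m where "m = polar f b (Q - c)"
  have pn: "pole f a n = A - c" and pm: "pole f b m = Q - c"
    by (simp_all add: n_def m_def pole_polar ffa ffb)
  have n1: "n \<bullet> pole f a n = 1" and m1: "m \<bullet> pole f b m = 1"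
    using Ap(2) Qp(2) unfolding pn pm by (simp_all add: ellipse_def n_def m_def inner_commute)
  obtain t1 t2 where "A = p + t1 *\<^sub>R v" "Q = p + t2 *\<^sub>R v" using Ap(1) Qp(1) by auto
  then have \<tau>: "pole f b m - pole f a n = (t2 - t1) *\<^sub>R v" "t2 - t1 \<noteq> 0"
    using AQ by (auto simp: pn pm algebra_simps)
  obtain \<kappa> where \<kappa>: "(n + \<kappa> *\<^sub>R (m - n)) \<bullet> pole f b (n + \<kappa> *\<^sub>R (m - n)) = 1"
    "pole f b (n + \<kappa> *\<^sub>R (m - n)) - pole f a n = (\<kappa> * (t2 - t1)) *\<^sub>R reflect n v"
    "reflect n v \<bullet> (n + \<kappa> *\<^sub>R (m - n)) = v \<bullet> m"
    using confocal_reflection[OF ffb ab n1 m1 \<tau>] by blast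
  define m' where "m' = n + \<kappa> *\<^sub>R (m - n)"
  define R' where "R' = c + pole f b m'"
  have "n \<noteq> 0" using n1 by auto
  then have bm: "billiard_map (ellipse c f a) (line_through p v) = line_through A (reflect n v)"
    unfolding billiard_map_def Let_def A[symmetric] tangent_space_ellipse[OF ffa Ap(2)]
    by (simp add: line_through_def n_def[symmetric] reflect_in_hyperplane)
  have R'e: "R' \<in> ellipse c f b"
    unfolding R'_def ellipse_pole_iff[OF ffb] m'_def by (rule \<kappa>(1))
  have pR: "polar f b (R' - c) = m'" by (simp add: R'_def polar_pole ffb)
  have "R' = A + (\<kappa> * (t2 - t1)) *\<^sub>R reflect n v"
    using \<kappa>(2) unfolding R'_def m'_def pn by (simp add: algebra_simps)
  then have "R' \<in> range (\<lambda>t. A + t *\<^sub>R reflect n v)" by blast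
  \<comment> \<open>The sign condition at \<open>R'\<close> is inherited from the one at
    \<open>Q\<close>.\<close>
  moreover have "0 \<le> reflect n v \<bullet> polar f b (R' - c)"
    unfolding pR unfolding m'_def \<kappa>(3) using Qp(3) by (simp add: m_def)
  ultimately have RR': "R = R'"
    unfolding R bm using last_point_eqI[OF ffb reflect_nonzero[OF v] _ R'e] by blast
  show thesis
    by (rule that[of \<kappa>]) (use R'e pR in \<open>simp_all add: RR' m'_def n_def m_def\<close>)
qed

section \<open>Collinear duals and concurrent lines\<close>

lemma direction_hyperplane:
  fixes n :: point
  assumes "n \<noteq> 0"
  shows "direction {Y. (Y - c) \<bullet> n = 1} = {u. u \<bullet> n = 0}"
proof (intro set_eqI iffI)
  fix u assume "u \<in> direction {Y. (Y - c) \<bullet> n = 1}"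
  then show "u \<in> {u. u \<bullet> n = 0}"
    by (auto simp: direction_def inner_diff_left)
next
  fix u assume u: "u \<in> {u. u \<bullet> n = 0}"
  define y where "y = c + (1 / (n \<bullet> n)) *\<^sub>R n"
  have "(y - c) \<bullet> n = 1" using assms by (simp add: y_def)
  moreover from this have "(y + u - c) \<bullet> n = 1"
    using u by (simp add: inner_diff_left inner_add_left)
  moreover have "u = (y + u) - y" by simp
  ultimately show "u \<in> direction {Y. (Y - c) \<bullet> n = 1}"
    unfolding direction_def by blast
qed

text \<open>In dimension two both complements are the line spanned by \<open>p\<close>.\<close>

lemma orthogonal_same_complement:
  fixes p k n :: point
  assumes "p \<noteq> 0" "k \<noteq> 0" "n \<noteq> 0" "p \<bullet> k = 0" "p \<bullet> n = 0"
  shows "{u. u \<bullet> k = 0} = {u. u \<bullet> n = 0}"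
proof -
  have span: "{u. u \<bullet> x = 0} = range (\<lambda>t. t *\<^sub>R p)" if "x \<noteq> 0" "p \<bullet> x = 0" for x :: point
  proof (intro set_eqI iffI)
    fix u assume "u \<in> {u. u \<bullet> x = 0}"
    then have u: "u$1 * x$1 + u$2 * x$2 = 0" by (simp add: inner_vec_def sum_2)
    have p: "p$1 * x$1 + p$2 * x$2 = 0" using that by (simp add: inner_vec_def sum_2)
    have x: "x$1 \<noteq> 0 \<or> x$2 \<noteq> 0" using that(1) by (simp add: vec_eq_iff forall_2)
    have pp: "p$1 * p$1 + p$2 * p$2 \<noteq> 0"
      using assms(1) by (simp add: vec_eq_iff forall_2 sum_squares_eq_zero_iff)
    have x1: "x$1 * (u$1 * p$2 - u$2 * p$1) = 0" and x2: "x$2 * (u$1 * p$2 - u$2 * p$1) = 0"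
      using u p by algebra+
    then have z: "u$1 * p$2 = u$2 * p$1" using x by auto
    define t where "t = (u$1 * p$1 + u$2 * p$2) / (p$1 * p$1 + p$2 * p$2)"
    have "u$1 * (p$1 * p$1 + p$2 * p$2) = (u$1 * p$1 + u$2 * p$2) * p$1"
      "u$2 * (p$1 * p$1 + p$2 * p$2) = (u$1 * p$1 + u$2 * p$2) * p$2"
      using z by algebra+
    then have "u = t *\<^sub>R p"
      using pp by (simp add: vec_eq_iff forall_2 t_def eq_divide_eq)
    then show "u \<in> range (\<lambda>t. t *\<^sub>R p)" by blast
  qed (use that in auto)
  show ?thesis using span assms by simp
qed

text \<open>A vector \<open>p\<close> orthogonal to \<open>d\<close> has the same product with all
  normals in \<open>S\<close>. If this product is nonzero, a multiple of \<open>p\<close> gives the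
  common affine point; if it is zero, all the lines are parallel to \<open>p\<close> and meet at
  infinity.\<close>

lemma collinear_normals_concurrent:
  fixes n d c :: point
  assumes S: "\<And>k. k \<in> S \<Longrightarrow> k \<noteq> 0 \<and> (\<exists>t. k = n + t *\<^sub>R d)" and d: "d \<noteq> 0" and nS: "n \<in> S"
  shows "\<exists>P. \<forall>k\<in>S. P \<in> projective_closure {Y. (Y - c) \<bullet> k = 1}"
proof -
  define p :: point where "p = vector [- d$2, d$1]"
  have pd: "p \<bullet> d = 0" by (simp add: p_def inner_vec_def sum_2)
  have p0: "p \<noteq> 0" using d by (auto simp: p_def vec_eq_iff forall_2)
  have pk: "p \<bullet> k = p \<bullet> n" if "k \<in> S" for k
    using S[OF that] pd by (auto simp: inner_add_right)
  show ?thesis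
  proof (cases "p \<bullet> n = 0")
    case False
    then have "Affine (c + (1 / (p \<bullet> n)) *\<^sub>R p) \<in> projective_closure {Y. (Y - c) \<bullet> k = 1}"
      if "k \<in> S" for k
      using pk[OF that] by (auto simp: projective_closure_def)
    then show ?thesis by blast
  next
    case True
    have "At_infinity {u. u \<bullet> n = 0} \<in> projective_closure {Y. (Y - c) \<bullet> k = 1}" if "k \<in> S" for k
      using orthogonal_same_complement[OF p0, of k n] S[OF that] S[OF nS] pk[OF that] True
      by (simp add: projective_closure_def direction_hyperplane)
    then show ?thesis by blast
  qed
qed

section \<open>The four tangents of two confocal ellipses\<close>

theorem mainTheorem3:
  fixes \<aa> \<bb> :: "point set" and l :: oriented_line and A B Q R :: point
  assumes "confocal_ellipses \<aa> \<bb>" and "\<aa> \<noteq> \<bb>"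
    and "is_oriented_line l"
    and "fst l \<inter> \<aa> \<noteq> {}" and "fst l \<inter> \<bb> \<noteq> {}"
    and "A = last_point \<aa> l" and "Q = last_point \<bb> l"
    and "B = last_point \<aa> (billiard_map \<bb> l)"
    and "R = last_point \<bb> (billiard_map \<aa> l)"
  shows "\<exists>P :: projective_point.
           P \<in> projective_closure (tangent_line \<aa> A) \<and>
           P \<in> projective_closure (tangent_line \<aa> B) \<and>
           P \<in> projective_closure (tangent_line \<bb> Q) \<and>
           P \<in> projective_closure (tangent_line \<bb> R)"
proof -
  obtain F G s1 s2 where s: "dist F G < s1" "dist F G < s2"
    and ab: "\<aa> = {X. dist X F + dist X G = s1}" "\<bb> = {X. dist X F + dist X G = s2}"
    using assms(1) by (auto simp: confocal_ellipses_def ellipse_with_foci_def)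
  define c f a b where "c = midpoint F G" and "f = (1/2) *\<^sub>R (F - G)"
    and "a = (s1/2)\<^sup>2" and "b = (s2/2)\<^sup>2"
  have ea: "\<aa> = ellipse c f a" and eb: "\<bb> = ellipse c f b"
    and ffa: "f \<bullet> f < a" and ffb: "f \<bullet> f < b"
    unfolding ab c_def f_def a_def b_def using sum_dist_eq_ellipse s by blast+
  have neq: "a \<noteq> b" using assms(2) ea eb by auto
  obtain p v where v: "norm v = 1" and l: "l = line_through p v"
    using assms(3) by (auto simp: is_oriented_line_def)
  have v0: "v \<noteq> 0" using v by auto
  have nea: "range (\<lambda>t. p + t *\<^sub>R v) \<inter> ellipse c f a \<noteq> {}"
    and neb: "range (\<lambda>t. p + t *\<^sub>R v) \<inter> ellipse c f b \<noteq> {}"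
    using assms(4,5) by (simp_all add: l ea eb line_through_def)
  note A = assms(6)[unfolded ea l] and Q = assms(7)[unfolded eb l]
    and B = assms(8)[unfolded ea eb l] and R = assms(9)[unfolded ea eb l]
  have Ae: "A \<in> ellipse c f a" and Qe: "Q \<in> ellipse c f b"
    using last_point_props[OF ffa v0 nea A] last_point_props[OF ffb v0 neb Q] by auto
  \<comment> \<open>Distinct confocal ellipses are disjoint, since a point determines the sum of its
    distances to the foci.\<close>
  have AQ: "A \<noteq> Q"
  proof
    assume "A = Q"
    then have "s1 = s2" using Ae Qe ab by (auto simp flip: ea eb)
    then show False using assms(2) ab by simp
  qed
  define n m where "n = polar f a (A - c)" and "m = polar f b (Q - c)"
  obtain \<kappa> where Re: "R \<in> ellipse c f b" and \<kappa>: "polar f b (R - c) = n + \<kappa> *\<^sub>R (m - n)"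
    using confocal_billiard[OF ffa ffb neq v0 AQ nea neb A Q R] unfolding n_def m_def by blast
  \<comment> \<open>The same result with the two ellipses exchanged; the line of duals is now
    parametrised from \<open>m\<close> towards \<open>n\<close>.\<close>
  obtain \<mu> where Be: "B \<in> ellipse c f a" and \<mu>: "polar f a (B - c) = m + \<mu> *\<^sub>R (n - m)"
    using confocal_billiard[OF ffb ffa neq[symmetric] v0 AQ[symmetric] neb nea Q A B]
    unfolding n_def m_def by blast
  have nz: "polar f \<rho> (X - c) \<noteq> 0" if "X \<in> ellipse c f \<rho>" for X \<rho>
    using that by (auto simp: ellipse_def)
  have "n \<bullet> pole f a n = 1" "m \<bullet> pole f b m = 1"
    using Ae Qe by (simp_all add: n_def m_def pole_polar ffa ffb ellipse_def inner_commute)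
  \<comment> \<open>Equal duals would mean a common tangent, excluded for distinct confocal
    ellipses.\<close>
  then have nm: "m - n \<noteq> 0"
    using neq pole_shift[of f b n a] by (auto simp: inner_add_right)
  define S where "S = {n, m, polar f b (R - c), polar f a (B - c)}"
  have "k \<noteq> 0 \<and> (\<exists>t. k = n + t *\<^sub>R (m - n))" if "k \<in> S" for k
  proof
    show "k \<noteq> 0" using that nz Ae Qe Re Be by (auto simp: S_def n_def m_def)
    \<comment> \<open>On the line from \<open>n\<close> to \<open>m\<close> the four duals have the
      parameters 0, 1, \<open>\<kappa>\<close> and \<open>1 - \<mu>\<close>.\<close>
    have "n = n + 0 *\<^sub>R (m - n)" "m = n + 1 *\<^sub>R (m - n)"
      "polar f a (B - c) = n + (1 - \<mu>) *\<^sub>R (m - n)"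
      by (simp_all add: \<mu> algebra_simps)
    then show "\<exists>t. k = n + t *\<^sub>R (m - n)" using that \<kappa> unfolding S_def by blast
  qed
  then obtain P where "\<forall>k\<in>S. P \<in> projective_closure {Y. (Y - c) \<bullet> k = 1}"
    using collinear_normals_concurrent[OF _ nm, of S n c] by (auto simp: S_def)
  then show ?thesis
    unfolding ea eb tangent_line_ellipse[OF ffa Ae] tangent_line_ellipse[OF ffa Be]
      tangent_line_ellipse[OF ffb Qe] tangent_line_ellipse[OF ffb Re]
    by (auto simp: S_def n_def m_def)
qed

end
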